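(* Let $l<n$. Let the boundary matrix $B=(B_u,B_p)$ (a full-rank $n\times 2n$ matrix) satisfy $$(B_u,B_p)\begin{pmatrix}R_1^UH+R_1^S-F^{-1}C\\ C\end{pmatrix}=0,$$ where $C$ is an $n\times(n-l)$ matrix with $L_1^UC=0$, and let $$b_0(t)=B_uR_1^UJ(t)+(B_p-B_uF^{-1})D(t),$$ where $D(t)\in\mathbb R^n$ satisfies $L_1^UD(t)=0$. Assume the initial value $u_0$ is compatible up to order $2$ with the boundary data of the conservation laws: $\hat B(-F\partial_x)^iu_0(0)=\partial_t^i\hat b(0)$ for $i=0,1,2$. Then compatibility of order $2$ holds for the relaxation system, i.e. $$(B_u,B_p)\begin{pmatrix}\partial_t^iu\\ \partial_t^ip\end{pmatrix}(0,0)=\partial_t^ib_\epsilon(0),\quad i=0,1,2,\qquad b_\epsilon(t)=b_0(t)+\epsilon b_1(t)+\epsilon^2b_2(t),$$ provided that the initial data are $$\begin{pmatrix}u\\ p\end{pmatrix}(x,0)=\begin{pmatrix}u_0\\ 0\end{pmatrix}+\epsilon\begin{pmatrix}0\\ -(\bar A-F^2)u_{0x}\end{pmatrix}+\epsilon^2\begin{pmatrix}0\\ p_{02}\end{pmatrix},\qquad p_{02}=-2F(\bar A-F^2)\partial_{xx}u_0,$$ and the boundary data satisfy $$\partial_t^ib_1(0)=(B_u,B_p)m_{i1},\qquad \partial_t^ib_2(0)=(B_u,B_p)m_{i2},\qquad i=0,1,2,$$ $$\partial_t^iD(0)=-(0,C)\,T^{-1}(-F\partial_x)^iu_0(0),\qquad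 i=0,1,2,$$ where the $m_{ik}$ (given in the context) are evaluated at $x=0$.
   Context: $F$ is a real invertible $n\times n$ matrix, $T$ is invertible with $T^{-1}FT=\mathrm{diag}(\lambda_1,\dots,\lambda_n)$, $\lambda_1,\dots,\lambda_l>0>\lambda_{l+1},\dots,\lambda_n$, and $\bar A=T\,\mathrm{diag}(a_1,\dots,a_n)T^{-1}$ with $a_j>0$. $T=(R_1^U,R_1^S)$ ($R_1^U$: first $l$ columns), $T^{-1}=\binom{L_1^U}{L_1^S}$ ($L_1^U$: first $l$ rows). The conservation laws are $u_t+Fu_x=0$, $x>0$, with boundary condition $\hat Bu(0,t)=\hat b(t)$, $\hat B$ an $l\times n$ matrix with $\hat BR_1^U$ invertible, and initial value $u_0(x)$. $H=-(\hat BR_1^U)^{-1}\hat BR_1^S$ and $J(t)=(\hat BR_1^U)^{-1}\hat b(t)$. $(0,C)$ denotes the $n\times n$ matrix whose first $l$ columns are zero. All data are sufficiently smooth for the derivatives appearing to exist. The relaxation system, for $\epsilon>0$, is $$\begin{pmatrix}u\\ p\end{pmatrix}_t+A\begin{pmatrix}u\\ p\end{pmatrix}_x=\frac1\epsilon\begin{pmatrix}0&0\\ 0&-I_n\end{pmatrix}\begin{pmatrix}u\\ p\end{pmatrix},\qquad A=\begin{pmatrix}F&I_n\\ \bar A-F^2&-F\end{pmatrix},$$ with boundary condition $B(u,p)^T(0,t)=b_\epsilon(t)$. The time derivatives at $t=0$ are those prescribed by the system: $$\begin{pmatrix}\partial_t^iu\\ \partial_t^ip\end{pmatrix}\Big|_{t=0}=\Big(-A\partial_x+\frac1\epsilon\begin{pmatrix}0&0\\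 0&-I_n\end{pmatrix}\Big)^i\begin{pmatrix}u\\ p\end{pmatrix}\Big|_{t=0}.$$ Definitions of $m_{ik}$: $$m_{01}=\begin{pmatrix}0\\ -(\bar A-F^2)u_{0x}\end{pmatrix},\quad m_{02}=\begin{pmatrix}0\\ p_{02}\end{pmatrix},\quad m_{11}=\begin{pmatrix}(\bar A-F^2)\partial_{xx}u_0\\ -F(\bar A-F^2)\partial_{xx}u_0-p_{02}\end{pmatrix},\quad m_{12}=\begin{pmatrix}-\partial_xp_{02}\\ F\partial_xp_{02}\end{pmatrix},$$ $$m_{21}=\begin{pmatrix}\partial_xp_{02}\\ -\bar A(\bar A-F^2)\partial_{xxx}u_0-2F\partial_xp_{02}\end{pmatrix},\quad m_{22}=\begin{pmatrix}0\\ \bar A\partial_{xx}p_{02}\end{pmatrix}.$$ *)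

theory Defs
  imports "HOL-Analysis.Derivative" "Jordan_Normal_Form.Gauss_Jordan_Elimination"
    "Jordan_Normal_Form.DL_Rank"
begin

unbundle no vec_syntax
unbundle no inner_syntax

text \<open>The dimensions \<open>l\<close> and \<open>n\<close> are natural numbers, so matrices and vectors are those of
  Jordan Normal Form, with entries indexed from \<open>0\<close>. The case \<open>l = 0\<close> is included.\<close>

text \<open>Meaningful for invertible square matrices only.\<close>

definition inv_mat :: "real mat \<Rightarrow> real mat" where
  "inv_mat A = the (mat_inverse A)"

definition left_cols :: "nat \<Rightarrow> real mat \<Rightarrow> real mat" where
  "left_cols l A = mat (dim_row A) l (\<lambda>(i, j). A $$ (i, j))"

definition right_cols :: "nat \<Rightarrow> real mat \<Rightarrow> real mat" where
  "right_cols l A = mat (dim_row A) (dim_col A - l) (\<lambda>(i, j). A $$ (i, l + j))"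

definition top_rows :: "nat \<Rightarrow> real mat \<Rightarrow> real mat" where
  "top_rows l A = mat l (dim_col A) (\<lambda>(i, j). A $$ (i, j))"

text \<open>The block matrix \<open>(A, B)\<close>, the column counterpart of \<^const>\<open>append_rows\<close>.\<close>

definition append_cols :: "real mat \<Rightarrow> real mat \<Rightarrow> real mat" (infixr \<open>@\<^sub>c\<close> 65) where
  "A @\<^sub>c B = four_block_mat A B (0\<^sub>m 0 (dim_col A)) (0\<^sub>m 0 (dim_col B))"

text \<open>Space and time range over the half-line \<open>{0..}\<close>. The derivative of a vector function is
  taken componentwise within this set, so that it is the one-sided derivative at \<open>0\<close>, and values
  of functions at negative arguments are irrelevant.\<close>

definition half_deriv :: "(real \<Rightarrow> real vec) \<Rightarrow> real \<Rightarrow> real vec" (\<open>\<partial>\<close>) where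
  "\<partial> f = (\<lambda>x. vec (dim_vec (f x)) (\<lambda>j. vector_derivative (\<lambda>y. f y $ j) (at x within {0..})))"

definition times_differentiable :: "nat \<Rightarrow> (real \<Rightarrow> real vec) \<Rightarrow> bool" where
  "times_differentiable k f \<longleftrightarrow>
     (\<forall>i<k. \<forall>x\<ge>0. \<forall>j<dim_vec (f x). (\<lambda>y. (\<partial> ^^ i) f y $ j) differentiable (at x within {0..}))"

text \<open>The \<open>i\<close>-th time derivative at time \<open>0\<close> of a solution of \<open>u\<^sub>t + F u\<^sub>x = 0\<close> with initial value
  \<open>u0\<close>, namely \<open>(-F \<partial>\<^sub>x)\<^sup>i u0\<close>.\<close>

definition cons_time_deriv :: "real mat \<Rightarrow> nat \<Rightarrow> (real \<Rightarrow> real vec) \<Rightarrow> real \<Rightarrow> real vec" where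
  "cons_time_deriv F i = (\<lambda>f x. (- F) *\<^sub>v \<partial> f x) ^^ i"

definition relax_matrix :: "real mat \<Rightarrow> real mat \<Rightarrow> real mat" where
  "relax_matrix F Abar = four_block_mat F (1\<^sub>m (dim_row F)) (Abar - F * F) (- F)"

definition relax_source :: "nat \<Rightarrow> real mat" where
  "relax_source n = four_block_mat (0\<^sub>m n n) (0\<^sub>m n n) (0\<^sub>m n n) (- 1\<^sub>m n)"

text \<open>The \<open>i\<close>-th time derivative at time \<open>0\<close>, as prescribed by the relaxation system, of a solution
  \<open>(u, p)\<close> with initial value \<open>w\<close>.\<close>

definition relax_time_deriv ::
  "real mat \<Rightarrow> real mat \<Rightarrow> real \<Rightarrow> nat \<Rightarrow> (real \<Rightarrow> real vec) \<Rightarrow> real \<Rightarrow> real vec" where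
  "relax_time_deriv F Abar \<epsilon> i =
     (\<lambda>w x. (- relax_matrix F Abar) *\<^sub>v \<partial> w x + (1 / \<epsilon>) \<cdot>\<^sub>v (relax_source (dim_row F) *\<^sub>v w x)) ^^ i"

text \<open>In \<open>m\<^sub>i\<^sub>k\<close> below, \<open>i\<close> is the order of the time derivative and \<open>k\<close> the power of \<open>\<epsilon>\<close>.\<close>

definition m01 :: "real mat \<Rightarrow> real mat \<Rightarrow> (real \<Rightarrow> real vec) \<Rightarrow> real \<Rightarrow> real vec" where
  "m01 F Abar u0 x = 0\<^sub>v (dim_row F) @\<^sub>v (- ((Abar - F * F) *\<^sub>v \<partial> u0 x))"

definition m02 :: "real mat \<Rightarrow> (real \<Rightarrow> real vec) \<Rightarrow> real \<Rightarrow> real vec" where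
  "m02 F p02 x = 0\<^sub>v (dim_row F) @\<^sub>v p02 x"

definition m11 ::
  "real mat \<Rightarrow> real mat \<Rightarrow> (real \<Rightarrow> real vec) \<Rightarrow> (real \<Rightarrow> real vec) \<Rightarrow> real \<Rightarrow> real vec" where
  "m11 F Abar u0 p02 x =
     ((Abar - F * F) *\<^sub>v (\<partial> ^^ 2) u0 x) @\<^sub>v
     (- (F * (Abar - F * F) *\<^sub>v (\<partial> ^^ 2) u0 x) - p02 x)"

definition m12 :: "real mat \<Rightarrow> (real \<Rightarrow> real vec) \<Rightarrow> real \<Rightarrow> real vec" where
  "m12 F p02 x = (- \<partial> p02 x) @\<^sub>v (F *\<^sub>v \<partial> p02 x)"

definition m21 ::
  "real mat \<Rightarrow> real mat \<Rightarrow> (real \<Rightarrow> real vec) \<Rightarrow> (real \<Rightarrow> real vec) \<Rightarrow> real \<Rightarrow> real vec" where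
  "m21 F Abar u0 p02 x =
     \<partial> p02 x @\<^sub>v
     (- (Abar * (Abar - F * F) *\<^sub>v (\<partial> ^^ 3) u0 x) - 2 \<cdot>\<^sub>v (F *\<^sub>v \<partial> p02 x))"

definition m22 :: "real mat \<Rightarrow> real mat \<Rightarrow> (real \<Rightarrow> real vec) \<Rightarrow> real \<Rightarrow> real vec" where
  "m22 F Abar p02 x = 0\<^sub>v (dim_row F) @\<^sub>v (Abar *\<^sub>v (\<partial> ^^ 2) p02 x)"

end

theory Submission
  imports Defs
begin

text \<open>
  Write \<open>N = Abar - F\<^sup>2\<close>. The equations are \<open>u\<^sub>t = - F u\<^sub>x - p\<^sub>x\<close> and
  \<open>p\<^sub>t = F p\<^sub>x - N u\<^sub>x - p / \<epsilon>\<close>, so each time derivative is computed from space derivatives of the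
  preceding one, and the factor \<open>1 / \<epsilon>\<close> is harmless as long as \<open>p\<close> has no term of order
  \<open>\<epsilon>\<^sup>0\<close>. The initial data are prepared for this: the term \<open>- \<epsilon> N u\<^sub>0\<^sub>x\<close> in \<open>p\<close> cancels \<open>- N u\<^sub>x\<close>
  in \<open>p\<^sub>t\<close>, and \<open>p02\<close> is chosen to cancel the leading term of \<open>\<partial>\<^sub>t\<^sup>2 p\<close>, which is
  \<open>(N F + F N) \<partial>\<^sub>x\<^sub>x u\<^sub>0 + p02\<close>. The matrices \<open>F\<close> and \<open>Abar\<close> are diagonal in the same basis, hence
  \<open>N F = F N\<close> and \<open>p02 = - 2 F N \<partial>\<^sub>x\<^sub>x u\<^sub>0\<close> does it. What remains
  (\<open>relax_time_deriv_expansion\<close>) is the exact expansion, for \<open>i \<le> 2\<close>,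

  \<open>\<partial>\<^sub>t\<^sup>i (u, p) = ((- F \<partial>\<^sub>x)\<^sup>i u\<^sub>0, 0) + \<epsilon> m\<^sub>i\<^sub>1 + \<epsilon>\<^sup>2 m\<^sub>i\<^sub>2\<close>.

  At the boundary, the terms of order \<open>\<epsilon>\<close> and \<open>\<epsilon>\<^sup>2\<close> agree with those of \<open>beps\<close> by the choice of
  \<open>b1\<close> and \<open>b2\<close>. For the leading term one has to show \<open>Bu v = \<partial>\<^sub>t\<^sup>i b0 (0)\<close> with
  \<open>v = (- F \<partial>\<^sub>x)\<^sup>i u\<^sub>0 (0)\<close>. Compatibility of the conservation laws turns \<open>\<partial>\<^sub>t\<^sup>i bhat (0)\<close> into \<open>Bhat v\<close>, and
  \<open>\<partial>\<^sub>t\<^sup>i D (0)\<close> is prescribed as \<open>- (0, C) T\<^sup>-\<^sup>1 v\<close>, so that \<open>\<partial>\<^sub>t\<^sup>i b0 (0)\<close> becomes a linear function of \<open>v\<close>. Splitting \<open>v = R1U y\<^sub>U + R1S y\<^sub>S\<close> along the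
  positive and negative invariant subspaces of \<open>F\<close>, its \<open>y\<^sub>U\<close> part is \<open>Bu R1U y\<^sub>U\<close> directly, and its \<open>y\<^sub>S\<close> part is
  \<open>Bu R1S y\<^sub>S\<close> exactly because of the condition imposed on \<open>(Bu, Bp)\<close> (\<open>boundary_reduction\<close>).
\<close>

section \<open>Vectors, blocks and inverses\<close>

lemma mult_uminus_vec:
  fixes A :: "real mat"
  assumes "A \<in> carrier_mat nr nc" "v \<in> carrier_vec nc"
  shows "A *\<^sub>v (- v) = - (A *\<^sub>v v)"
  using assms by (intro eq_vecI) auto

lemmas mat_vec_distribs = mult_add_distrib_mat_vec[where nr = n and nc = n]
  mult_minus_distrib_mat_vec[where nr = n and nc = n] mult_mat_vec[where nr = n and nc = n]
  mult_uminus_vec[where nr = n and nc = n] for n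

text \<open>Gauss--Jordan elimination succeeds exactly on the units of the matrix ring, and
  an invertible matrix is such a unit once its inverse is seen to have the right dimensions.\<close>

lemma inv_mat_inverse:
  assumes A: "A \<in> carrier_mat n n" and inv: "invertible_mat A"
  shows "inv_mat A \<in> carrier_mat n n" "inv_mat A * A = 1\<^sub>m n" "A * inv_mat A = 1\<^sub>m n"
proof -
  from inv A obtain B where AB: "A * B = 1\<^sub>m n" and BA: "B * A = 1\<^sub>m (dim_row B)"
    unfolding invertible_mat_def inverts_mat_def by auto
  have "dim_row B = n" using arg_cong[OF BA, of dim_col] A by simp
  moreover have "dim_col B = n" using arg_cong[OF AB, of dim_col] by simp
  ultimately have "A \<in> Units (ring_mat TYPE(real) n ())"
    using A AB BA by (auto simp: Units_def ring_mat_simps intro!: bexI[of _ B])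
  then obtain B' where "mat_inverse A = Some B'"
    using mat_inverse(1)[OF A, of "()"] by (cases "mat_inverse A") auto
  then show "inv_mat A \<in> carrier_mat n n" "inv_mat A * A = 1\<^sub>m n" "A * inv_mat A = 1\<^sub>m n"
    using mat_inverse(2)[OF A, of B'] by (auto simp: inv_mat_def)
qed

lemma append_cols_carrier:
  assumes "A \<in> carrier_mat n k" "B \<in> carrier_mat n m"
  shows "A @\<^sub>c B \<in> carrier_mat n (k + m)"
  using assms unfolding append_cols_def by auto

lemma append_cols_mult_vec:
  assumes A: "A \<in> carrier_mat n k" and B: "B \<in> carrier_mat n m"
    and v: "v \<in> carrier_vec k" and w: "w \<in> carrier_vec m"
  shows "(A @\<^sub>c B) *\<^sub>v (v @\<^sub>v w) = A *\<^sub>v v + B *\<^sub>v w"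
proof -
  have "(A @\<^sub>c B) *\<^sub>v (v @\<^sub>v w) = (A *\<^sub>v v + B *\<^sub>v w) @\<^sub>v (0\<^sub>m 0 k *\<^sub>v v + 0\<^sub>m 0 m *\<^sub>v w)"
    unfolding append_cols_def using A B v w
    by (subst four_block_mat_mult_vec[of A n k B m _ 0]) auto
  then show ?thesis using A B by (auto intro!: eq_vecI)
qed

lemma left_right_cols_append:
  assumes "A \<in> carrier_mat n m" "l \<le> m"
  shows "left_cols l A @\<^sub>c right_cols l A = A"
  using assms unfolding append_cols_def left_cols_def right_cols_def
  by (intro eq_matI) auto

text \<open>Applied to \<open>F\<close> and \<open>Abar\<close>, this makes \<open>- 2 F (Abar - F\<^sup>2) \<partial>\<^sub>x\<^sub>x u\<^sub>0\<close> the right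
  choice of \<open>p02\<close>.\<close>

lemma conjugate_diagonals_commute:
  fixes T S :: "'a :: comm_ring_1 mat"
  assumes T: "T \<in> carrier_mat n n" and S: "S \<in> carrier_mat n n" and ST: "S * T = 1\<^sub>m n"
  shows "(T * mat_diag n f * S) * (T * mat_diag n g * S)
       = (T * mat_diag n g * S) * (T * mat_diag n f * S)"
proof -
  have prod: "(T * mat_diag n f * S) * (T * mat_diag n g * S)
      = T * mat_diag n (\<lambda>i. f i * g i) * S" for f g
  proof -
    note [simp] = T S assoc_mult_mat[of _ n n _ n _ n] mult_carrier_mat[of _ n n _ n]
    have cancel: "S * (T * X) = X" if "X \<in> carrier_mat n n" for X
      using that ST T S left_mult_one_mat[of X n n] by (metis assoc_mult_mat)
    have "(T * mat_diag n f * S) * (T * mat_diag n g * S)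
        = T * (mat_diag n f * (mat_diag n g * S))" by (simp add: cancel)
    also have "\<dots> = T * ((mat_diag n f * mat_diag n g) * S)"
      by (simp del: mat_diag_diag)
    finally show ?thesis by simp
  qed
  show ?thesis unfolding prod by (simp add: mult.commute)
qed

section \<open>One-sided derivatives of vector functions on the half-line\<close>

text \<open>The operator \<open>\<partial>\<close> is total and returns an arbitrary value where there is no derivative, so linearity
  holds only for differentiable functions. A relation that asserts the existence of the derivative,
  together with the dimensions, can be composed without side conditions.\<close>

definition has_half_deriv :: "nat \<Rightarrow> (real \<Rightarrow> real vec) \<Rightarrow> (real \<Rightarrow> real vec) \<Rightarrow> bool" where
  "has_half_deriv n f f' \<longleftrightarrow>
     (\<forall>x\<ge>0. f x \<in> carrier_vec n \<and> f' x \<in> carrier_vec n \<and>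
       (\<forall>j<n. ((\<lambda>y. f y $ j) has_real_derivative f' x $ j) (at x within {0..})))"

lemma has_half_derivI:
  assumes "\<And>x. x \<ge> 0 \<Longrightarrow> f x \<in> carrier_vec n" "\<And>x. x \<ge> 0 \<Longrightarrow> f' x \<in> carrier_vec n"
    and "\<And>x j. x \<ge> 0 \<Longrightarrow> j < n \<Longrightarrow>
      ((\<lambda>y. f y $ j) has_real_derivative f' x $ j) (at x within {0..})"
  shows "has_half_deriv n f f'"
  using assms unfolding has_half_deriv_def by blast

lemma has_half_derivD:
  assumes "has_half_deriv n f f'" "x \<ge> 0"
  shows "f x \<in> carrier_vec n" "f' x \<in> carrier_vec n"
    "j < n \<Longrightarrow> ((\<lambda>y. f y $ j) has_real_derivative f' x $ j) (at x within {0..})"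
  using assms unfolding has_half_deriv_def by blast+

lemma has_half_deriv_imp_eq:
  assumes "has_half_deriv n f f'" "x \<ge> 0"
  shows "\<partial> f x = f' x"
proof (rule eq_vecI)
  note D = has_half_derivD[OF assms]
  show "dim_vec (\<partial> f x) = dim_vec (f' x)"
    using D by (simp add: half_deriv_def)
  fix j assume "j < dim_vec (f' x)"
  then have j: "j < n" using D(2) by auto
  \<comment> \<open>The one-sided limit at \<open>0\<close> still determines the derivative uniquely.\<close>
  have "at x within {0..} \<noteq> bot"
    using at_le[of "{x<..}" "{0..}" x] assms(2)
    by (force simp: bot_unique subset_eq)
  then show "\<partial> f x $ j = f' x $ j"
    using D(1) D(3)[OF j] j
    by (auto simp: half_deriv_def has_real_derivative_iff_has_vector_derivative
        intro!: vector_derivative_within)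
qed

text \<open>The data are constrained on the half-line only, so they can be replaced by explicit formulas
  only there.\<close>

lemma has_half_deriv_cong:
  assumes f: "has_half_deriv n f f'" and eq: "\<And>x. x \<ge> 0 \<Longrightarrow> g x = f x"
    "\<And>x. x \<ge> 0 \<Longrightarrow> g' x = f' x"
  shows "has_half_deriv n g g'"
proof (rule has_half_derivI)
  fix x :: real and j assume x: "x \<ge> 0" and j: "j < n"
  show "((\<lambda>y. g y $ j) has_real_derivative g' x $ j) (at x within {0..})"
    unfolding eq(2)[OF x]
    by (rule has_field_derivative_transform_within[OF has_half_derivD(3)[OF f x j], of 1])
      (use x eq(1) in auto)
qed (use has_half_derivD[OF f] eq in auto)

text \<open>A component of the product is a finite sum of constant multiples of components. The rules for
  scalar multiples, negation and differences are reduced to this one and to sums.\<close>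

lemma has_half_deriv_mult_mat:
  assumes A: "A \<in> carrier_mat m n" and f: "has_half_deriv n f f'"
  shows "has_half_deriv m (\<lambda>x. A *\<^sub>v f x) (\<lambda>x. A *\<^sub>v f' x)"
proof (rule has_half_derivI)
  fix x :: real and j assume x: "x \<ge> 0" and j: "j < m"
  have expand: "(A *\<^sub>v v) $ j = (\<Sum>i = 0..<n. A $$ (j, i) * v $ i)" if "v \<in> carrier_vec n" for v
    using A j that by (auto simp: scalar_prod_def)
  have "((\<lambda>y. \<Sum>i = 0..<n. A $$ (j, i) * f y $ i) has_real_derivative
      (\<Sum>i = 0..<n. A $$ (j, i) * f' x $ i)) (at x within {0..})"
    by (intro DERIV_sum DERIV_cmult has_half_derivD(3)[OF f x]) auto
  then show "((\<lambda>y. (A *\<^sub>v f y) $ j) has_real_derivative (A *\<^sub>v f' x) $ j) (at x within {0..})"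
    unfolding expand[OF has_half_derivD(2)[OF f x]]
    by (rule has_field_derivative_transform_within[of _ _ _ _ 1])
      (use x expand has_half_derivD(1)[OF f] in auto)
qed (use A has_half_derivD[OF f] in auto)

lemma has_half_deriv_add:
  assumes f: "has_half_deriv n f f'" and g: "has_half_deriv n g g'"
  shows "has_half_deriv n (\<lambda>x. f x + g x) (\<lambda>x. f' x + g' x)"
proof (rule has_half_derivI)
  fix x :: real and j assume x: "x \<ge> 0" and j: "j < n"
  note D = has_half_derivD[OF f] has_half_derivD[OF g]
  have "((\<lambda>y. f y $ j + g y $ j) has_real_derivative f' x $ j + g' x $ j) (at x within {0..})"
    by (intro DERIV_add D x j)
  moreover have "(f' x + g' x) $ j = f' x $ j + g' x $ j"
    using D(5)[OF x] j by auto
  ultimately show "((\<lambda>y. (f y + g y) $ j) has_real_derivative (f' x + g' x) $ j) (at x within {0..})"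
    by (simp, elim has_field_derivative_transform_within[of _ _ _ _ 1])
      (use x j carrier_vecD[OF D(4)] in auto)
qed (use has_half_derivD[OF f] has_half_derivD[OF g] in auto)

lemma has_half_deriv_smult:
  assumes f: "has_half_deriv n f f'"
  shows "has_half_deriv n (\<lambda>x. c \<cdot>\<^sub>v f x) (\<lambda>x. c \<cdot>\<^sub>v f' x)"
proof (rule has_half_deriv_cong[OF has_half_deriv_mult_mat[OF _ f]])
  show "c \<cdot>\<^sub>m 1\<^sub>m n \<in> carrier_mat n n" by simp
  have "c \<cdot>\<^sub>v v = (c \<cdot>\<^sub>m 1\<^sub>m n) *\<^sub>v v" if "v \<in> carrier_vec n" for v
    using that by (auto simp: smult_scalar_prod_distrib[of _ n])
  then show "x \<ge> 0 \<Longrightarrow> c \<cdot>\<^sub>v f x = (c \<cdot>\<^sub>m 1\<^sub>m n) *\<^sub>v f x"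
    "x \<ge> 0 \<Longrightarrow> c \<cdot>\<^sub>v f' x = (c \<cdot>\<^sub>m 1\<^sub>m n) *\<^sub>v f' x" for x
    using has_half_derivD[OF f] by blast+
qed

lemma has_half_deriv_uminus:
  assumes f: "has_half_deriv n f f'"
  shows "has_half_deriv n (\<lambda>x. - f x) (\<lambda>x. - f' x)"
  by (rule has_half_deriv_cong[OF has_half_deriv_smult[OF f, of "-1"]])
    (use has_half_derivD[OF f] in \<open>auto intro!: eq_vecI\<close>)

lemma has_half_deriv_diff:
  assumes f: "has_half_deriv n f f'" and g: "has_half_deriv n g g'"
  shows "has_half_deriv n (\<lambda>x. f x - g x) (\<lambda>x. f' x - g' x)"
  by (rule has_half_deriv_cong[OF has_half_deriv_add[OF f has_half_deriv_uminus[OF g]]])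
    (use has_half_derivD[OF f] has_half_derivD[OF g] in
      \<open>auto intro!: minus_add_uminus_vec[of _ n]\<close>)

lemma has_half_deriv_append:
  assumes f: "has_half_deriv n f f'" and g: "has_half_deriv m g g'"
  shows "has_half_deriv (n + m) (\<lambda>x. f x @\<^sub>v g x) (\<lambda>x. f' x @\<^sub>v g' x)"
proof (rule has_half_derivI)
  fix x :: real and j assume x: "x \<ge> 0" and j: "j < n + m"
  note D = has_half_derivD[OF f] has_half_derivD[OF g]
  have idx: "(v @\<^sub>v w) $ j = (if j < n then v $ j else w $ (j - n))"
    if "v \<in> carrier_vec n" "w \<in> carrier_vec m" for v w :: "real vec"
    using that j by auto
  have "((\<lambda>y. if j < n then f y $ j else g y $ (j - n)) has_real_derivative
      (if j < n then f' x $ j else g' x $ (j - n))) (at x within {0..})"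
    using D(3,6)[OF x] j by (cases "j < n") auto
  then show "((\<lambda>y. (f y @\<^sub>v g y) $ j) has_real_derivative (f' x @\<^sub>v g' x) $ j) (at x within {0..})"
    unfolding idx[OF D(2)[OF x] D(5)[OF x]]
    by (rule has_field_derivative_transform_within[of _ _ _ _ 1])
      (use x idx D(1,4) in auto)
qed (use has_half_derivD[OF f] has_half_derivD[OF g] in auto)

lemmas has_half_deriv_intros = has_half_deriv_mult_mat has_half_deriv_add has_half_deriv_smult
  has_half_deriv_uminus has_half_deriv_diff has_half_deriv_append

lemma dim_half_deriv_iter [simp]: "dim_vec ((\<partial> ^^ i) f x) = dim_vec (f x)"
  by (induction i arbitrary: x) (simp_all add: half_deriv_def)

lemma times_differentiable_has_half_deriv:
  assumes f: "times_differentiable k f" "\<forall>x\<ge>0. f x \<in> carrier_vec n" and i: "i < k"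
  shows "has_half_deriv n ((\<partial> ^^ i) f) ((\<partial> ^^ Suc i) f)"
proof (rule has_half_derivI)
  fix x :: real and j assume x: "x \<ge> 0" and j: "j < n"
  have dim: "dim_vec (f x) = n" using f(2) x by auto
  then have "(\<lambda>y. (\<partial> ^^ i) f y $ j) differentiable (at x within {0..})"
    using f(1) i x j unfolding times_differentiable_def by auto
  then show "((\<lambda>y. (\<partial> ^^ i) f y $ j) has_real_derivative (\<partial> ^^ Suc i) f x $ j)
      (at x within {0..})"
    unfolding has_real_derivative_iff_has_vector_derivative
    using dim j by (simp add: half_deriv_def vector_derivative_works)
qed (use f(2) in \<open>auto intro!: carrier_vecI simp del: funpow.simps\<close>)

text \<open>Higher derivatives of a function given by a formula on the half-line are read off a chain of
  explicit functions. The induction goes through because one-sided derivatives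
  depend only on values in the half-line.\<close>

lemma half_deriv_iter_eq:
  assumes G: "\<And>i. i < k \<Longrightarrow> has_half_deriv n (G i) (G (Suc i))"
    and f: "\<And>x. x \<ge> 0 \<Longrightarrow> f x = G 0 x"
    and i: "i \<le> k" and x: "x \<ge> 0"
  shows "(\<partial> ^^ i) f x = G i x"
  using i x
proof (induction i arbitrary: x)
  case 0
  then show ?case using f by simp
next
  case (Suc i)
  then have "has_half_deriv n ((\<partial> ^^ i) f) (G (Suc i))"
    by (intro has_half_deriv_cong[OF G[of i]]) auto
  then show ?case using Suc.prems by (simp add: has_half_deriv_imp_eq)
qed

section \<open>Time derivatives prescribed by the two systems\<close>

text \<open>One time step in block form:
  \<open>(u, p)\<^sub>t = (- F u\<^sub>x - p\<^sub>x, F p\<^sub>x - (Abar - F\<^sup>2) u\<^sub>x - p / \<epsilon>)\<close>. The iterate need only be known on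
  the half-line.\<close>

lemma relax_time_deriv_Suc:
  assumes F: "F \<in> carrier_mat n n" and Abar: "Abar \<in> carrier_mat n n"
    and U: "has_half_deriv n U U'" and P: "has_half_deriv n P P'"
    and UP: "\<And>x. x \<ge> 0 \<Longrightarrow> relax_time_deriv F Abar \<epsilon> i w x = U x @\<^sub>v P x"
    and x: "x \<ge> 0"
  shows "relax_time_deriv F Abar \<epsilon> (Suc i) w x
       = (- (F *\<^sub>v U' x) - P' x) @\<^sub>v
         (F *\<^sub>v P' x - (Abar - F * F) *\<^sub>v U' x - (1 / \<epsilon>) \<cdot>\<^sub>v P x)"
proof -
  note car = F Abar has_half_derivD(1,2)[OF U x] has_half_derivD(1,2)[OF P x]
  have deriv: "\<partial> (relax_time_deriv F Abar \<epsilon> i w) x = U' x @\<^sub>v P' x"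
    by (rule has_half_deriv_imp_eq[OF has_half_deriv_cong[OF has_half_deriv_append[OF U P]] x])
      (use UP in auto)
  have "relax_time_deriv F Abar \<epsilon> (Suc i) w x
      = (- relax_matrix F Abar) *\<^sub>v (U' x @\<^sub>v P' x)
        + (1 / \<epsilon>) \<cdot>\<^sub>v (relax_source n *\<^sub>v (U x @\<^sub>v P x))"
    using deriv UP[OF x] F by (simp add: relax_time_deriv_def)
  also have "(- relax_matrix F Abar) *\<^sub>v (U' x @\<^sub>v P' x)
      = - ((F *\<^sub>v U' x + P' x) @\<^sub>v ((Abar - F * F) *\<^sub>v U' x - F *\<^sub>v P' x))"
    using car minus_add_uminus_vec[of "(Abar - F * F) *\<^sub>v U' x" n "F *\<^sub>v P' x"]
    by (subst uminus_mult_mat_vec)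
      (auto simp: relax_matrix_def minus_carrier_mat
        four_block_mat_mult_vec[of F n n "1\<^sub>m n" n "Abar - F * F" n "- F" "U' x" "P' x"])
  also have "relax_source n *\<^sub>v (U x @\<^sub>v P x) = 0\<^sub>v n @\<^sub>v - P x"
    using car unfolding relax_source_def
    by (subst four_block_mat_mult_vec[of _ n n _ n _ n]) auto
  finally show ?thesis
    using car by (auto intro!: eq_vecI)
qed

text \<open>The leading terms are those of the conservation laws with \<open>p = 0\<close>, and no negative powers of
  \<open>\<epsilon>\<close> occur. For \<open>i = 1\<close> the correction \<open>- \<epsilon> (Abar - F\<^sup>2) u\<^sub>0\<^sub>x\<close> removes the constant term of \<open>p\<^sub>t\<close>, so
  dividing by \<open>\<epsilon>\<close> once more is possible; for \<open>i = 2\<close> the correction \<open>p02\<close> removes the constant term of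
  \<open>p\<^sub>t\<^sub>t\<close>, given that \<open>F\<close> and \<open>Abar\<close> commute. Four derivatives of \<open>u0\<close> are used because \<open>p02\<close>, which
  contains two, is differentiated twice.\<close>

lemma relax_time_deriv_expansion:
  assumes F: "F \<in> carrier_mat n n" and Abar: "Abar \<in> carrier_mat n n"
    and comm: "F * Abar = Abar * F"
    and u0: "\<forall>x\<ge>0. u0 x \<in> carrier_vec n" "times_differentiable 4 u0"
    and p02: "\<forall>x\<ge>0. p02 x = (- 2) \<cdot>\<^sub>v (F * (Abar - F * F) *\<^sub>v (\<partial> ^^ 2) u0 x)"
    and w: "\<forall>x\<ge>0. w x = (u0 x @\<^sub>v 0\<^sub>v n)
           + \<epsilon> \<cdot>\<^sub>v (0\<^sub>v n @\<^sub>v (- ((Abar - F * F) *\<^sub>v \<partial> u0 x)))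
           + \<epsilon>\<^sup>2 \<cdot>\<^sub>v (0\<^sub>v n @\<^sub>v p02 x)"
    and \<epsilon>: "\<epsilon> \<noteq> 0" and x: "x \<ge> 0"
  shows "relax_time_deriv F Abar \<epsilon> 0 w x = (cons_time_deriv F 0 u0 x @\<^sub>v 0\<^sub>v n)
           + \<epsilon> \<cdot>\<^sub>v m01 F Abar u0 x + \<epsilon>\<^sup>2 \<cdot>\<^sub>v m02 F p02 x"
    and "relax_time_deriv F Abar \<epsilon> 1 w x = (cons_time_deriv F 1 u0 x @\<^sub>v 0\<^sub>v n)
           + \<epsilon> \<cdot>\<^sub>v m11 F Abar u0 p02 x + \<epsilon>\<^sup>2 \<cdot>\<^sub>v m12 F p02 x"
    and "relax_time_deriv F Abar \<epsilon> 2 w x = (cons_time_deriv F 2 u0 x @\<^sub>v 0\<^sub>v n)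
           + \<epsilon> \<cdot>\<^sub>v m21 F Abar u0 p02 x + \<epsilon>\<^sup>2 \<cdot>\<^sub>v m22 F Abar p02 x"
proof -
  \<comment> \<open>With \<open>u i\<close> and \<open>q i\<close> for the \<open>i\<close>-th space derivatives of \<open>u0\<close> and \<open>p02\<close>, all time derivatives
    become linear combinations of matrix products applied to these vectors.\<close>
  define N where "N = Abar - F * F"
  define u where "u i = (\<partial> ^^ i) u0" for i
  define q where "q i = (\<lambda>x. (- 2) \<cdot>\<^sub>v (F *\<^sub>v (N *\<^sub>v u (2 + i) x)))" for i
  have N: "N \<in> carrier_mat n n" using F Abar by (simp add: N_def minus_carrier_mat)
  have FNv: "(F * N) *\<^sub>v v = F *\<^sub>v (N *\<^sub>v v)" if "v \<in> carrier_vec n" for v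
    using F N that by simp
  have N_comm: "N *\<^sub>v (F *\<^sub>v v) = F *\<^sub>v (N *\<^sub>v v)" if v: "v \<in> carrier_vec n" for v
  proof -
    have "N * F = F * N"
      unfolding N_def using F Abar comm
      by (simp add: minus_mult_distrib_mat[of _ n n] mult_minus_distrib_mat[of _ n n]
          assoc_mult_mat[of _ n n _ n _ n])
    then show ?thesis using F N v by (metis assoc_mult_mat_vec)
  qed
  have Abar_v: "Abar *\<^sub>v v = N *\<^sub>v v + F *\<^sub>v (F *\<^sub>v v)" if v: "v \<in> carrier_vec n" for v
    unfolding N_def using F Abar v by (auto simp: minus_mult_distrib_mat_vec[of _ n n])
  have u_car: "u i x \<in> carrier_vec n" if "x \<ge> 0" for i x
    using u0(1) that by (auto simp: u_def intro!: carrier_vecI)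
  have du: "has_half_deriv n (u i) (u (Suc i))" if "i < 4" for i
    unfolding u_def by (rule times_differentiable_has_half_deriv[OF u0(2,1) that])
  have q_car: "q i x \<in> carrier_vec n" if "x \<ge> 0" for i x
    using F N u_car[OF that] by (simp add: q_def)
  have dq: "has_half_deriv n (q i) (q (Suc i))" if "i < 2" for i
    unfolding q_def using du[of "2 + i"] F N that
    by (intro has_half_deriv_smult has_half_deriv_mult_mat) auto
  have p02_q: "(\<partial> ^^ i) p02 x = q i x" if "i \<le> 2" "x \<ge> 0" for i x
  proof (rule half_deriv_iter_eq[where G = q, OF dq _ that])
    show "p02 x = q 0 x" if "x \<ge> 0" for x
      using p02 that u_car[OF that] FNv by (simp add: q_def u_def flip: N_def)
  qed
  define U1 where "U1 = (\<lambda>x. \<epsilon> \<cdot>\<^sub>v (N *\<^sub>v u 2 x) - F *\<^sub>v u 1 x - \<epsilon>\<^sup>2 \<cdot>\<^sub>v q 1 x)"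
  define P1 where "P1 = (\<lambda>x. \<epsilon>\<^sup>2 \<cdot>\<^sub>v (F *\<^sub>v q 1 x) - \<epsilon> \<cdot>\<^sub>v (F *\<^sub>v (N *\<^sub>v u 2 x) + q 0 x))"
  define U1' where "U1' = (\<lambda>x. \<epsilon> \<cdot>\<^sub>v (N *\<^sub>v u 3 x) - F *\<^sub>v u 2 x - \<epsilon>\<^sup>2 \<cdot>\<^sub>v q 2 x)"
  define P1' where "P1' = (\<lambda>x. \<epsilon>\<^sup>2 \<cdot>\<^sub>v (F *\<^sub>v q 2 x) - \<epsilon> \<cdot>\<^sub>v (F *\<^sub>v (N *\<^sub>v u 3 x) + q 1 x))"
  note [simp] = F N u_car q_car mult_mat_vec_carrier[OF F] mult_mat_vec_carrier[OF N]
    carrier_matD[OF F] carrier_matD[OF N] carrier_vecD[OF u_car] carrier_vecD[OF q_car]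
    mat_vec_distribs[of _ n]
  have s0: "relax_time_deriv F Abar \<epsilon> 0 w x
      = u 0 x @\<^sub>v (\<epsilon>\<^sup>2 \<cdot>\<^sub>v q 0 x - \<epsilon> \<cdot>\<^sub>v (N *\<^sub>v u 1 x))" if "x \<ge> 0" for x
  proof -
    have "p02 x = q 0 x" using p02_q[of 0 x] that by simp
    moreover have "u0 = u 0" "\<partial> u0 = u 1" by (simp_all add: u_def)
    ultimately show ?thesis
      using w that unfolding N_def[symmetric]
      by (auto intro!: eq_vecI simp: relax_time_deriv_def simp del: index_mult_mat_vec)
  qed
  have s1: "relax_time_deriv F Abar \<epsilon> 1 w x = U1 x @\<^sub>v P1 x" if x: "x \<ge> 0" for x
  proof -
    have "has_half_deriv n (u 0) (u 1)" using du[of 0] by simp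
    moreover have "has_half_deriv n (\<lambda>x. \<epsilon>\<^sup>2 \<cdot>\<^sub>v q 0 x - \<epsilon> \<cdot>\<^sub>v (N *\<^sub>v u 1 x))
        (\<lambda>x. \<epsilon>\<^sup>2 \<cdot>\<^sub>v q 1 x - \<epsilon> \<cdot>\<^sub>v (N *\<^sub>v u 2 x))"
      using du[of 1] dq[of 0] N by (intro has_half_deriv_intros) (auto simp: numeral_2_eq_2)
    ultimately have "relax_time_deriv F Abar \<epsilon> (Suc 0) w x
      = (- (F *\<^sub>v u 1 x) - (\<epsilon>\<^sup>2 \<cdot>\<^sub>v q 1 x - \<epsilon> \<cdot>\<^sub>v (N *\<^sub>v u 2 x))) @\<^sub>v
        (F *\<^sub>v (\<epsilon>\<^sup>2 \<cdot>\<^sub>v q 1 x - \<epsilon> \<cdot>\<^sub>v (N *\<^sub>v u 2 x)) - N *\<^sub>v u 1 x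
          - (1 / \<epsilon>) \<cdot>\<^sub>v (\<epsilon>\<^sup>2 \<cdot>\<^sub>v q 0 x - \<epsilon> \<cdot>\<^sub>v (N *\<^sub>v u 1 x)))"
      unfolding N_def by (rule relax_time_deriv_Suc[OF F Abar _ _ s0[unfolded N_def] x])
    also have "\<dots> = U1 x @\<^sub>v P1 x"
      unfolding U1_def P1_def using x \<epsilon>
      by (auto intro!: arg_cong2[of _ _ _ _ append_vec] eq_vecI
          simp: field_simps power2_eq_square simp del: index_mult_mat_vec)
    finally show ?thesis by simp
  qed
  have s2: "relax_time_deriv F Abar \<epsilon> 2 w x
      = (F *\<^sub>v (F *\<^sub>v u 2 x) + \<epsilon> \<cdot>\<^sub>v q 1 x) @\<^sub>v
        (\<epsilon> \<cdot>\<^sub>v (- (Abar *\<^sub>v (N *\<^sub>v u 3 x)) - 2 \<cdot>\<^sub>v (F *\<^sub>v q 1 x)) + \<epsilon>\<^sup>2 \<cdot>\<^sub>v (Abar *\<^sub>v q 2 x))"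
    if x: "x \<ge> 0" for x
  proof -
    have "has_half_deriv n U1 U1'"
      unfolding U1_def U1'_def using du[of 1] du[of 2] dq[of 1] F N
      by (intro has_half_deriv_intros) (auto simp: numeral_2_eq_2 numeral_3_eq_3)
    moreover have "has_half_deriv n P1 P1'"
      unfolding P1_def P1'_def using du[of 2] dq[of 0] dq[of 1] F N
      by (intro has_half_deriv_intros) (auto simp: numeral_2_eq_2 numeral_3_eq_3)
    ultimately have "relax_time_deriv F Abar \<epsilon> (Suc 1) w x
      = (- (F *\<^sub>v U1' x) - P1' x) @\<^sub>v (F *\<^sub>v P1' x - N *\<^sub>v U1' x - (1 / \<epsilon>) \<cdot>\<^sub>v P1 x)"
      unfolding N_def by (rule relax_time_deriv_Suc[OF F Abar _ _ s1 x])
    also have "- (F *\<^sub>v U1' x) - P1' x = F *\<^sub>v (F *\<^sub>v u 2 x) + \<epsilon> \<cdot>\<^sub>v q 1 x"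
      unfolding U1'_def P1'_def using x
      by (auto intro!: eq_vecI simp: algebra_simps simp del: index_mult_mat_vec)
    \<comment> \<open>At order \<open>\<epsilon>\<^sup>0\<close> the contributions are \<open>N F u\<^sub>x\<^sub>x + F N u\<^sub>x\<^sub>x + p02\<close>, and commutation lets
      \<open>p02\<close> cancel the other two.\<close>
    also have "F *\<^sub>v P1' x - N *\<^sub>v U1' x - (1 / \<epsilon>) \<cdot>\<^sub>v P1 x
      = \<epsilon> \<cdot>\<^sub>v (- (Abar *\<^sub>v (N *\<^sub>v u 3 x)) - 2 \<cdot>\<^sub>v (F *\<^sub>v q 1 x)) + \<epsilon>\<^sup>2 \<cdot>\<^sub>v (Abar *\<^sub>v q 2 x)"
    proof -
      have q0: "q 0 x = (- 2) \<cdot>\<^sub>v (F *\<^sub>v (N *\<^sub>v u 2 x))" by (simp add: q_def)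
      show ?thesis
        unfolding U1'_def P1'_def P1_def q0 using x \<epsilon>
        by (auto intro!: eq_vecI simp: Abar_v N_comm field_simps power2_eq_square
            simp del: index_mult_mat_vec)
    qed
    finally show ?thesis by (simp add: numeral_2_eq_2)
  qed
  have c0: "cons_time_deriv F 0 u0 x = u 0 x" by (simp add: cons_time_deriv_def u_def)
  have c1: "cons_time_deriv F 1 u0 x = - (F *\<^sub>v u 1 x)" if "x \<ge> 0" for x
    using u_car[OF that, of 1] by (simp add: cons_time_deriv_def u_def)
  have c2: "cons_time_deriv F 2 u0 x = F *\<^sub>v (F *\<^sub>v u 2 x)"
  proof -
    have "has_half_deriv n (cons_time_deriv F 1 u0) (\<lambda>x. - (F *\<^sub>v u 2 x))"
      by (rule has_half_deriv_cong[OF has_half_deriv_uminus[OF has_half_deriv_mult_mat[OF F du[of 1]]]])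
        (use c1 in \<open>auto simp: numeral_2_eq_2\<close>)
    then have "\<partial> (cons_time_deriv F 1 u0) x = - (F *\<^sub>v u 2 x)"
      using x by (rule has_half_deriv_imp_eq)
    then have "cons_time_deriv F 2 u0 x = (- F) *\<^sub>v (- (F *\<^sub>v u 2 x))"
      by (simp add: cons_time_deriv_def numeral_2_eq_2)
    then show ?thesis using x by simp
  qed
  have u_eqs: "\<partial> u0 = u 1" "(\<partial> ^^ 2) u0 = u 2" "(\<partial> ^^ 3) u0 = u 3" by (simp_all add: u_def)
  have p_eqs: "p02 x = q 0 x" "\<partial> p02 x = q 1 x" "(\<partial> ^^ 2) p02 x = q 2 x"
    using p02_q[of 0 x] p02_q[of 1 x] p02_q[of 2 x] x by simp_all
  have FN_u: "F * N *\<^sub>v u i x = F *\<^sub>v (N *\<^sub>v u i x)" "Abar * N *\<^sub>v u i x = Abar *\<^sub>v (N *\<^sub>v u i x)" for i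
    by (fact assoc_mult_mat_vec[OF F N u_car[OF x]] assoc_mult_mat_vec[OF Abar N u_car[OF x]])+
  note defs = m01_def m02_def m11_def m12_def m21_def m22_def
  show "relax_time_deriv F Abar \<epsilon> 0 w x = (cons_time_deriv F 0 u0 x @\<^sub>v 0\<^sub>v n)
      + \<epsilon> \<cdot>\<^sub>v m01 F Abar u0 x + \<epsilon>\<^sup>2 \<cdot>\<^sub>v m02 F p02 x"
    unfolding s0[OF x] c0 defs u_eqs p_eqs N_def[symmetric] using x
    by (auto intro!: eq_vecI simp del: index_mult_mat_vec)
  show "relax_time_deriv F Abar \<epsilon> 1 w x = (cons_time_deriv F 1 u0 x @\<^sub>v 0\<^sub>v n)
      + \<epsilon> \<cdot>\<^sub>v m11 F Abar u0 p02 x + \<epsilon>\<^sup>2 \<cdot>\<^sub>v m12 F p02 x"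
    unfolding s1[OF x] c1[OF x] defs u_eqs p_eqs N_def[symmetric] FN_u U1_def P1_def using x
    by (auto intro!: eq_vecI simp: algebra_simps simp del: index_mult_mat_vec)
  show "relax_time_deriv F Abar \<epsilon> 2 w x = (cons_time_deriv F 2 u0 x @\<^sub>v 0\<^sub>v n)
      + \<epsilon> \<cdot>\<^sub>v m21 F Abar u0 p02 x + \<epsilon>\<^sup>2 \<cdot>\<^sub>v m22 F Abar p02 x"
    unfolding s2[OF x] c2 defs u_eqs p_eqs N_def[symmetric] FN_u using x Abar
    by (auto intro!: eq_vecI simp: algebra_simps simp del: index_mult_mat_vec)
qed

section \<open>The boundary condition\<close>

text \<open>Let \<open>S v = (y\<^sub>U, y\<^sub>S)\<close>, so that \<open>v = R1U y\<^sub>U + R1S y\<^sub>S\<close>. Then \<open>M Bhat v = y\<^sub>U - H y\<^sub>S\<close> by the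
  definition of \<open>H\<close>, and the boundary condition applied to \<open>y\<^sub>S\<close> reads
  \<open>(Bp - Bu G) C y\<^sub>S = - Bu (R1U H + R1S) y\<^sub>S\<close>. On the left-hand side the two terms
  \<open>Bu R1U H y\<^sub>S\<close> cancel, leaving \<open>Bu (R1U y\<^sub>U + R1S y\<^sub>S)\<close>. The matrix \<open>G\<close> stands for \<open>F\<^sup>-\<^sup>1\<close>.\<close>

lemma boundary_reduction:
  assumes ln: "l \<le> n" and T: "T \<in> carrier_mat n n" and S: "S \<in> carrier_mat n n"
    and TS: "T * S = 1\<^sub>m n"
    and R1U: "R1U = left_cols l T" and R1S: "R1S = right_cols l T"
    and Bhat: "Bhat \<in> carrier_mat l n"
    and M: "M \<in> carrier_mat l l" "M * (Bhat * R1U) = 1\<^sub>m l"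
    and H: "H = - (M * (Bhat * R1S))"
    and Bu: "Bu \<in> carrier_mat n n" and Bp: "Bp \<in> carrier_mat n n"
    and C: "C \<in> carrier_mat n (n - l)" and G: "G \<in> carrier_mat n n"
    and bc: "(Bu @\<^sub>c Bp) * ((R1U * H + R1S - G * C) @\<^sub>r C) = 0\<^sub>m n (n - l)"
    and v: "v \<in> carrier_vec n"
  shows "Bu *\<^sub>v (R1U *\<^sub>v (M *\<^sub>v (Bhat *\<^sub>v v)))
      + (Bp - Bu * G) *\<^sub>v (- ((0\<^sub>m n l @\<^sub>c C) *\<^sub>v (S *\<^sub>v v))) = Bu *\<^sub>v v"
proof -
  define yU where "yU = vec_first (S *\<^sub>v v) l"
  define yS where "yS = vec_last (S *\<^sub>v v) (n - l)"
  have yU: "yU \<in> carrier_vec l" and yS: "yS \<in> carrier_vec (n - l)"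
    by (simp_all add: yU_def yS_def)
  have y: "S *\<^sub>v v = yU @\<^sub>v yS"
    using ln S v unfolding yU_def yS_def by (subst vec_first_last_append) auto
  have R1Uc: "R1U \<in> carrier_mat n l" and R1Sc: "R1S \<in> carrier_mat n (n - l)"
    using T by (auto simp: R1U R1S left_cols_def right_cols_def)
  have Hc: "H \<in> carrier_mat l (n - l)" using M Bhat R1Sc by (simp add: H)
  let ?p = "R1U *\<^sub>v yU" and ?s = "R1S *\<^sub>v yS" and ?h = "R1U *\<^sub>v (H *\<^sub>v yS)" and ?c = "C *\<^sub>v yS"
  have car [simp]: "?p \<in> carrier_vec n" "?s \<in> carrier_vec n" "?h \<in> carrier_vec n"
    "?c \<in> carrier_vec n" "G *\<^sub>v ?c \<in> carrier_vec n" "H *\<^sub>v yS \<in> carrier_vec l"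
    using R1Uc R1Sc Hc C G yU yS by simp_all
  have "v = T *\<^sub>v (S *\<^sub>v v)"
    using T S TS v by (metis assoc_mult_mat_vec one_mult_mat_vec)
  also have "\<dots> = (R1U @\<^sub>c R1S) *\<^sub>v (yU @\<^sub>v yS)"
    unfolding y R1U R1S using left_right_cols_append[OF T ln] by simp
  also have "\<dots> = ?p + ?s"
    by (rule append_cols_mult_vec[OF R1Uc R1Sc yU yS])
  finally have v_eq: "v = ?p + ?s" .
  have "M *\<^sub>v (Bhat *\<^sub>v ?p) = (M * (Bhat * R1U)) *\<^sub>v yU"
    using M(1) Bhat R1Uc yU
    by (simp add: assoc_mult_mat_vec[of M l l _ l] assoc_mult_mat_vec[of Bhat l n _ l])
  then have MBp: "M *\<^sub>v (Bhat *\<^sub>v ?p) = yU" using M(2) yU by simp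
  have "H *\<^sub>v yS = - ((M * (Bhat * R1S)) *\<^sub>v yS)"
    unfolding H using M Bhat R1Sc yS by (subst uminus_mult_mat_vec) auto
  then have MBs: "M *\<^sub>v (Bhat *\<^sub>v ?s) = - (H *\<^sub>v yS)"
    using M(1) Bhat R1Sc yS
    by (simp add: assoc_mult_mat_vec[of M l l _ "n - l"] assoc_mult_mat_vec[of Bhat l n _ "n - l"])
  have "M *\<^sub>v (Bhat *\<^sub>v v) = yU + - (H *\<^sub>v yS)"
    unfolding v_eq using M(1) Bhat R1Uc R1Sc yU yS
    by (simp add: mult_add_distrib_mat_vec[of _ l n] mult_add_distrib_mat_vec[of _ l l] MBp MBs)
  then have incoming: "R1U *\<^sub>v (M *\<^sub>v (Bhat *\<^sub>v v)) = ?p + - ?h"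
    using R1Uc yU by (simp add: mult_add_distrib_mat_vec[of _ n l] mult_uminus_vec[of _ n l])
  have outgoing: "(0\<^sub>m n l @\<^sub>c C) *\<^sub>v (S *\<^sub>v v) = ?c"
  proof -
    have "0\<^sub>m n l *\<^sub>v yU = 0\<^sub>v n" using yU by (intro eq_vecI) auto
    then show ?thesis
      unfolding y using append_cols_mult_vec[OF _ C yU yS, of "0\<^sub>m n l"] by simp
  qed
  have "((Bu @\<^sub>c Bp) * ((R1U * H + R1S - G * C) @\<^sub>r C)) *\<^sub>v yS = 0\<^sub>v n"
    unfolding bc using yS by (auto intro!: eq_vecI)
  moreover have "((Bu @\<^sub>c Bp) * ((R1U * H + R1S - G * C) @\<^sub>r C)) *\<^sub>v yS
      = (Bu @\<^sub>c Bp) *\<^sub>v (((R1U * H + R1S - G * C) @\<^sub>r C) *\<^sub>v yS)"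
    using append_cols_carrier[OF Bu Bp] C G yS
    by (intro assoc_mult_mat_vec carrier_append_rows) (auto intro!: minus_carrier_mat)
  moreover have "((R1U * H + R1S - G * C) @\<^sub>r C) *\<^sub>v yS = (?h + ?s - G *\<^sub>v ?c) @\<^sub>v ?c"
    using R1Uc R1Sc Hc C G yS
    by (subst mat_mult_append[of _ n "n - l" _ n])
      (auto simp: minus_mult_distrib_mat_vec[of _ n "n - l"] add_mult_distrib_mat_vec[of _ n "n - l"]
        intro!: minus_carrier_mat)
  ultimately have "Bu *\<^sub>v (?h + ?s - G *\<^sub>v ?c) + Bp *\<^sub>v ?c = 0\<^sub>v n"
    using append_cols_mult_vec[OF Bu Bp, of "?h + ?s - G *\<^sub>v ?c" ?c] by simp
  then have zero: "(Bu *\<^sub>v ?h + Bu *\<^sub>v ?s - Bu *\<^sub>v (G *\<^sub>v ?c) + Bp *\<^sub>v ?c) $ j = 0" if "j < n" for j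
    using that Bu by (simp add: mult_minus_distrib_mat_vec[of _ n n] mult_add_distrib_mat_vec[of _ n n])
  have "Bu *\<^sub>v (?p + - ?h) + (Bp - Bu * G) *\<^sub>v (- ?c) = Bu *\<^sub>v (?p + ?s)"
  proof (rule eq_vecI)
    fix j assume "j < dim_vec (Bu *\<^sub>v (?p + ?s))"
    then have j: "j < n" using Bu by simp
    show "(Bu *\<^sub>v (?p + - ?h) + (Bp - Bu * G) *\<^sub>v (- ?c)) $ j = (Bu *\<^sub>v (?p + ?s)) $ j"
      using zero[OF j] j Bu Bp G
      by (simp add: mult_add_distrib_mat_vec[of _ n n] mult_uminus_vec[of _ n n]
          minus_mult_distrib_mat_vec[of _ n n] del: index_mult_mat_vec)
  qed (use Bu Bp G in auto)
  then show ?thesis unfolding incoming outgoing using v_eq by simp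
qed

theorem theorem6p1:
  fixes l n :: nat
    and F T Abar Bhat Bu Bp C R1U R1S L1U H :: "real mat"
    and lam a :: "nat \<Rightarrow> real"
    and bhat J D b0 b1 b2 u0 p02 :: "real \<Rightarrow> real vec"
    and w0 beps :: "real \<Rightarrow> real \<Rightarrow> real vec"
  assumes "l < n"
    (* the matrices F, T, Abar and their blocks *)
    and "F \<in> carrier_mat n n" and "invertible_mat F"
    and "T \<in> carrier_mat n n" and "invertible_mat T"
    and "inv_mat T * F * T = mat_diag n lam"
    and "\<forall>j<l. lam j > 0" and "\<forall>j. l \<le> j \<and> j < n \<longrightarrow> lam j < 0"
    and "\<forall>j<n. a j > 0"
    and "Abar = T * mat_diag n a * inv_mat T"
    and "R1U = left_cols l T" and "R1S = right_cols l T"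
    and "L1U = top_rows l (inv_mat T)"
    (* the boundary condition of the conservation laws *)
    and "Bhat \<in> carrier_mat l n" and "invertible_mat (Bhat * R1U)"
    and "\<forall>t\<ge>0. bhat t \<in> carrier_vec l" and "times_differentiable 2 bhat"
    and "H = - (inv_mat (Bhat * R1U) * (Bhat * R1S))"
    and "\<forall>t\<ge>0. J t = inv_mat (Bhat * R1U) *\<^sub>v bhat t"
    (* the boundary matrix of the relaxation system *)
    and "Bu \<in> carrier_mat n n" and "Bp \<in> carrier_mat n n"
    and "vec_space.rank n (Bu @\<^sub>c Bp) = n"
    and "C \<in> carrier_mat n (n - l)" and "L1U * C = 0\<^sub>m l (n - l)"
    and "(Bu @\<^sub>c Bp) * ((R1U * H + R1S - inv_mat F * C) @\<^sub>r C) = 0\<^sub>m n (n - l)"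
    (* the leading boundary data b0 *)
    and "\<forall>t\<ge>0. D t \<in> carrier_vec n" and "times_differentiable 2 D"
    and "\<forall>t\<ge>0. L1U *\<^sub>v D t = 0\<^sub>v l"
    and "\<forall>t\<ge>0. b0 t = Bu *\<^sub>v (R1U *\<^sub>v J t) + (Bp - Bu * inv_mat F) *\<^sub>v D t"
    (* compatibility of order 2 for the conservation laws *)
    and "\<forall>x\<ge>0. u0 x \<in> carrier_vec n" and "times_differentiable 4 u0"
    and "\<forall>i\<in>{0, 1, 2}. Bhat *\<^sub>v cons_time_deriv F i u0 0 = (\<partial> ^^ i) bhat 0"
    (* the initial data of the relaxation system *)
    and "\<forall>x\<ge>0. p02 x = (- 2) \<cdot>\<^sub>v (F * (Abar - F * F) *\<^sub>v (\<partial> ^^ 2) u0 x)"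
    and "\<forall>\<epsilon>>0. \<forall>x\<ge>0. w0 \<epsilon> x =
           (u0 x @\<^sub>v 0\<^sub>v n)
           + \<epsilon> \<cdot>\<^sub>v (0\<^sub>v n @\<^sub>v (- ((Abar - F * F) *\<^sub>v \<partial> u0 x)))
           + \<epsilon>\<^sup>2 \<cdot>\<^sub>v (0\<^sub>v n @\<^sub>v p02 x)"
    (* the boundary data of the relaxation system *)
    and "\<forall>t\<ge>0. b1 t \<in> carrier_vec n" and "times_differentiable 2 b1"
    and "b1 0 = (Bu @\<^sub>c Bp) *\<^sub>v m01 F Abar u0 0"
    and "\<partial> b1 0 = (Bu @\<^sub>c Bp) *\<^sub>v m11 F Abar u0 p02 0"
    and "(\<partial> ^^ 2) b1 0 = (Bu @\<^sub>c Bp) *\<^sub>v m21 F Abar u0 p02 0"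
    and "\<forall>t\<ge>0. b2 t \<in> carrier_vec n" and "times_differentiable 2 b2"
    and "b2 0 = (Bu @\<^sub>c Bp) *\<^sub>v m02 F p02 0"
    and "\<partial> b2 0 = (Bu @\<^sub>c Bp) *\<^sub>v m12 F p02 0"
    and "(\<partial> ^^ 2) b2 0 = (Bu @\<^sub>c Bp) *\<^sub>v m22 F Abar p02 0"
    and "\<forall>i\<in>{0, 1, 2}. (\<partial> ^^ i) D 0 =
           - ((0\<^sub>m n l @\<^sub>c C) *\<^sub>v (inv_mat T *\<^sub>v cons_time_deriv F i u0 0))"
    and "\<forall>\<epsilon>>0. \<forall>t\<ge>0. beps \<epsilon> t = b0 t + \<epsilon> \<cdot>\<^sub>v b1 t + \<epsilon>\<^sup>2 \<cdot>\<^sub>v b2 t"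
  shows "\<forall>\<epsilon>>0. \<forall>i\<in>{0, 1, 2}.
           (Bu @\<^sub>c Bp) *\<^sub>v relax_time_deriv F Abar \<epsilon> i (w0 \<epsilon>) 0 = (\<partial> ^^ i) (beps \<epsilon>) 0"
proof (intro allI impI)
  fix \<epsilon> :: real assume \<epsilon>: "\<epsilon> > 0"
  note F = assms(2) and T = assms(4) and Bu = assms(20) and Bp = assms(21)
  define S where "S = inv_mat T"
  define M where "M = inv_mat (Bhat * R1U)"
  define E where "E = Bp - Bu * inv_mat F"
  define v where "v i = cons_time_deriv F i u0 0" for i
  have S: "S \<in> carrier_mat n n" "S * T = 1\<^sub>m n" "T * S = 1\<^sub>m n"
    unfolding S_def using inv_mat_inverse[OF T assms(5)] by auto
  have Finv: "inv_mat F \<in> carrier_mat n n" using inv_mat_inverse(1)[OF F assms(3)] .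
  have R1Uc: "R1U \<in> carrier_mat n l" using T by (simp add: assms(11) left_cols_def)
  have M: "M \<in> carrier_mat l l" "M * (Bhat * R1U) = 1\<^sub>m l"
    unfolding M_def using inv_mat_inverse[of "Bhat * R1U" l] assms(14,15) R1Uc by auto
  have E: "E \<in> carrier_mat n n" using Bp Bu Finv by (simp add: E_def minus_carrier_mat)
  have Abar: "Abar \<in> carrier_mat n n" unfolding assms(10) S_def[symmetric] using T S(1)
    by (metis mat_diag_dim mult_carrier_mat)

  have "T * (S * F * T) * S = (T * S) * F * (T * S)"
    using F T S(1) by (simp add: assoc_mult_mat[of _ n n _ n _ n])
  then have "F = T * mat_diag n lam * S"
    using F assms(6) S(3) by (simp flip: S_def)
  then have comm: "F * Abar = Abar * F"
    unfolding assms(10) S_def[symmetric] using conjugate_diagonals_commute[OF T S(1,2)] by simp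

  have w: "\<forall>x\<ge>0. w0 \<epsilon> x = (u0 x @\<^sub>v 0\<^sub>v n)
      + \<epsilon> \<cdot>\<^sub>v (0\<^sub>v n @\<^sub>v (- ((Abar - F * F) *\<^sub>v \<partial> u0 x))) + \<epsilon>\<^sup>2 \<cdot>\<^sub>v (0\<^sub>v n @\<^sub>v p02 x)"
    using assms(34) \<epsilon> by blast
  note expansion = relax_time_deriv_expansion[OF F Abar comm assms(30,31,33) w less_imp_neq[OF \<epsilon>, symmetric] order_refl]

  \<comment> \<open>The derivatives of \<open>beps\<close> are linear in those of the boundary data, since the matrices are
    constant in time.\<close>
  define G where "G i = (\<lambda>t. Bu *\<^sub>v (R1U *\<^sub>v (M *\<^sub>v (\<partial> ^^ i) bhat t)) + E *\<^sub>v (\<partial> ^^ i) D t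
      + \<epsilon> \<cdot>\<^sub>v (\<partial> ^^ i) b1 t + \<epsilon>\<^sup>2 \<cdot>\<^sub>v (\<partial> ^^ i) b2 t)" for i
  have beps_deriv: "(\<partial> ^^ i) (beps \<epsilon>) 0 = G i 0" if "i \<le> 2" for i
  proof (rule half_deriv_iter_eq[where G = G, OF _ _ that order_refl])
    show "has_half_deriv n (G i) (G (Suc i))" if "i < 2" for i
      unfolding G_def
      by (intro has_half_deriv_add has_half_deriv_smult has_half_deriv_mult_mat[OF Bu]
          has_half_deriv_mult_mat[OF R1Uc] has_half_deriv_mult_mat[OF M(1)]
          has_half_deriv_mult_mat[OF E]
          times_differentiable_has_half_deriv[where k = 2] assms that)
    show "beps \<epsilon> t = G 0 t" if "t \<ge> 0" for t
      using assms(19,29,46) \<epsilon> that by (simp add: G_def E_def M_def)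
  qed

  have compat: "(Bu @\<^sub>c Bp) *\<^sub>v relax_time_deriv F Abar \<epsilon> i (w0 \<epsilon>) 0 = (\<partial> ^^ i) (beps \<epsilon>) 0"
    if i: "i \<in> {0, 1, 2}"
      and w_deriv: "relax_time_deriv F Abar \<epsilon> i (w0 \<epsilon>) 0
        = (v i @\<^sub>v 0\<^sub>v n) + \<epsilon> \<cdot>\<^sub>v m1 + \<epsilon>\<^sup>2 \<cdot>\<^sub>v m2"
      and m: "m1 \<in> carrier_vec (n + n)" "m2 \<in> carrier_vec (n + n)"
      and b: "(\<partial> ^^ i) b1 0 = (Bu @\<^sub>c Bp) *\<^sub>v m1" "(\<partial> ^^ i) b2 0 = (Bu @\<^sub>c Bp) *\<^sub>v m2"
    for i m1 m2
  proof -
    have v: "v i \<in> carrier_vec n"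
      using i assms(2,30) by (auto simp: v_def cons_time_deriv_def numeral_2_eq_2 intro: carrier_vecI)
    have boundary_derivs: "(\<partial> ^^ i) bhat 0 = Bhat *\<^sub>v v i"
      "(\<partial> ^^ i) D 0 = - ((0\<^sub>m n l @\<^sub>c C) *\<^sub>v (S *\<^sub>v v i))"
      using bspec[OF assms(32) i] bspec[OF assms(45) i] by (simp_all add: v_def S_def)
    have "(Bu @\<^sub>c Bp) *\<^sub>v relax_time_deriv F Abar \<epsilon> i (w0 \<epsilon>) 0
        = (Bu @\<^sub>c Bp) *\<^sub>v (v i @\<^sub>v 0\<^sub>v n) + \<epsilon> \<cdot>\<^sub>v (\<partial> ^^ i) b1 0 + \<epsilon>\<^sup>2 \<cdot>\<^sub>v (\<partial> ^^ i) b2 0"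
      unfolding w_deriv b using append_cols_carrier[OF Bu Bp] m v
      by (simp add: mult_add_distrib_mat_vec[of _ n "n + n"] mult_mat_vec[of _ n "n + n"])
    also have "(Bu @\<^sub>c Bp) *\<^sub>v (v i @\<^sub>v 0\<^sub>v n) = Bu *\<^sub>v v i"
    proof -
      have "Bp *\<^sub>v 0\<^sub>v n = 0\<^sub>v n" using Bp by (intro eq_vecI) auto
      then show ?thesis using append_cols_mult_vec[OF Bu Bp v, of "0\<^sub>v n"] Bu v by simp
    qed
    also have "Bu *\<^sub>v v i = Bu *\<^sub>v (R1U *\<^sub>v (M *\<^sub>v (\<partial> ^^ i) bhat 0)) + E *\<^sub>v (\<partial> ^^ i) D 0"
      using boundary_reduction[OF less_imp_le[OF assms(1)] T S(1,3) assms(11,12,14) M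
          assms(18)[folded M_def] Bu Bp assms(23) Finv assms(25) v]
      by (simp add: boundary_derivs E_def)
    also have "\<dots> + \<epsilon> \<cdot>\<^sub>v (\<partial> ^^ i) b1 0 + \<epsilon>\<^sup>2 \<cdot>\<^sub>v (\<partial> ^^ i) b2 0 = (\<partial> ^^ i) (beps \<epsilon>) 0"
      using beps_deriv[of i] i by (auto simp: G_def)
    finally show ?thesis .
  qed

  have "dim_vec (p02 0) = n" using assms(33) F by simp
  then have m_car: "m01 F Abar u0 0 \<in> carrier_vec (n + n)" "m02 F p02 0 \<in> carrier_vec (n + n)"
    "m11 F Abar u0 p02 0 \<in> carrier_vec (n + n)" "m12 F p02 0 \<in> carrier_vec (n + n)"
    "m21 F Abar u0 p02 0 \<in> carrier_vec (n + n)" "m22 F Abar p02 0 \<in> carrier_vec (n + n)"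
    using F Abar dim_half_deriv_iter[of 1 p02 0]
    by (auto simp: m01_def m02_def m11_def m12_def m21_def m22_def intro!: carrier_vecI)
  show "\<forall>i\<in>{0, 1, 2}.
      (Bu @\<^sub>c Bp) *\<^sub>v relax_time_deriv F Abar \<epsilon> i (w0 \<epsilon>) 0 = (\<partial> ^^ i) (beps \<epsilon>) 0"
    using compat[of 0, OF _ expansion(1)[folded v_def] m_car(1,2)]
      compat[of 1, OF _ expansion(2)[folded v_def] m_car(3,4)]
      compat[of 2, OF _ expansion(3)[folded v_def] m_car(5,6)] assms(37-39,42-44) by simp
qed

end
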